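(* Let $(X,Y,\langle\cdot,\cdot\rangle)$ be a dual system and let $T:X\rightrightarrows Y$. Then $T$ is cyclically monotone if and only if one (equivalently, each) of the following conditions holds: (i) $\operatorname{Graph}T\subset[\varphi_T^{\langle\infty\rangle}\le c]$ (equivalently, $\operatorname{Graph}T\subset[\varphi_T^{\langle\infty\rangle}=c]$); (ii) $\varphi_T^{\langle\infty\rangle}\le P_T^{\langle\infty\rangle}$; (iii) $\varphi_T^{\langle\infty\rangle}\le\psi_T^{\langle\infty\rangle}$; (iv) $\psi_T^{\langle\infty\rangle}\ge c$; (v) $\operatorname{conv}P_T^{\langle\infty\rangle}\ge c$; (vi) there is a proper convex function $h:X\times Y\to\overline{\mathbb R}$ such that $c\le h\le P_T^{\langle\infty\rangle}$.
   Context: All vector spaces are real. A dual system $(X,Y,\langle\cdot,\cdot\rangle)$ consists of vector spaces $X,Y$ and a bilinear map $c=\langle\cdot,\cdot\rangle:X\times Y\to\mathbb{R}$. Put $Z=X\times Y$, $c(x,y)=\langle x,y\rangle$, and $z\cdot w=\langle x,v\rangle+\langle u,y\rangle$ for $z=(x,y)$, $w=(u,v)\in Z$. For $f:Z\to\overline{\mathbb{R}}$, $f^{\square}(z)=\sup_{z'\in Z}\{z\cdot z'-f(z')\}$, and $\operatorname{conv}f$ is the convex hull of $f$: $(\operatorname{conv}f)(z)=\inf\{t\in\mathbb R\mid(z,t)\in\operatorname{conv}(\operatorname{Epi}f)\}$ with $\operatorname{Epi}f=\{(z,t)\in Z\times\mathbb R\mid f(z)\le t\}$. A function is proper if it is not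 identically $+\infty$ and never takes the value $-\infty$. $[f\le g]=\{z\mid f(z)\le g(z)\}$, and similarly $[f=g]$; $f\le g$ without brackets means the inequality holds at every point. Conventions: $\sup\emptyset=-\infty$, $\inf\emptyset=+\infty$. $T:X\rightrightarrows Y$ is a multifunction with $\operatorname{Graph}T=\{(x,y)\mid y\in T(x)\}$ and $T^{-1}(y)=\{x\mid y\in T(x)\}$. $T$ is cyclically monotone if for every integer $n\ge2$ and all $(x_1,y_1),\dots,(x_n,y_n)\in\operatorname{Graph}T$, with $x_{n+1}=x_1$, $\sum_{i=1}^n\langle x_i-x_{i+1},y_i\rangle\ge0$. For finite $n\ge1$, $\varphi_T^{\langle n\rangle}(x,y)=\sup\{\langle x-x_1,y_1\rangle+\sum_{i=2}^n\langle x_{i-1}-x_i,y_i\rangle+\langle x_n,y\rangle\mid (x_i,y_i)\in\operatorname{Graph}T,\ 1\le i\le n\}$, and $\varphi_T^{\langle\infty\rangle}=\sup_{n\ge1}\varphi_T^{\langle n\rangle}$; $\psi_T^{\langle\infty\rangle}=(\varphi_T^{\langle\infty\rangle})^{\square}$. The functions $P_T^{\langle n\rangle}:Z\to\overline{\mathbb R}$ are: $P_T^{\langle1\rangle}=c_T$, where $c_T=c$ on $\operatorname{Graph}T$ and $+\infty$ elsewhere; $P_T^{\langle2\rangle}(x,y)=\inf\{\langle x_1,y\rangle+\langle x-x_1,y_2\rangle\mid x_1\in T^{-1}(y),\,y_2\in T(x)\}$; for $3\le n<\infty$, $P_T^{\langle n\rangle}(x,y)=\inf\{\langle x_1,y\rangle+\sum_{i=2}^{n-1}\langle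 x_i-x_{i-1},y_i\rangle+\langle x-x_{n-1},y_n\rangle\mid x_1\in T^{-1}(y),\,y_n\in T(x),\,(x_i,y_i)\in\operatorname{Graph}T\ (2\le i\le n-1)\}$; and $P_T^{\langle\infty\rangle}=\inf_{n\ge1}P_T^{\langle n\rangle}$. *)

theory Defs
  imports "HOL-Analysis.Analysis"
begin

text \<open>
  A dual system is a pair of real vector spaces (the types \<^typ>\<open>'x\<close> and \<^typ>\<open>'y\<close> of class
  \<^class>\<open>real_vector\<close>) with a bilinear map \<open>b\<close>. No topology, and no separation property of \<open>b\<close>,
  is assumed. A multifunction is a set-valued function \<open>T :: 'x \<Rightarrow> 'y set\<close>. On \<^typ>\<open>ereal\<close> the
  empty supremum is \<open>-\<infinity>\<close> and the empty infimum is \<open>\<infinity>\<close>.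
\<close>

definition coupling :: "('x::real_vector \<Rightarrow> 'y::real_vector \<Rightarrow> real) \<Rightarrow> 'x \<times> 'y \<Rightarrow> ereal" where
  "coupling b z = ereal (b (fst z) (snd z))"

definition pairing ::
  "('x::real_vector \<Rightarrow> 'y::real_vector \<Rightarrow> real) \<Rightarrow> 'x \<times> 'y \<Rightarrow> 'x \<times> 'y \<Rightarrow> real" where
  "pairing b z w = b (fst z) (snd w) + b (fst w) (snd z)"

text \<open>The first operand of the difference is real, so \<open>\<infinity> - \<infinity>\<close> never occurs.\<close>

definition square_conj ::
  "('x::real_vector \<Rightarrow> 'y::real_vector \<Rightarrow> real) \<Rightarrow> ('x \<times> 'y \<Rightarrow> ereal) \<Rightarrow> 'x \<times> 'y \<Rightarrow> ereal" where
  "square_conj b f z = (SUP w. ereal (pairing b z w) - f w)"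

definition Epi :: "('a::real_vector \<Rightarrow> ereal) \<Rightarrow> ('a \<times> real) set" where
  "Epi f = {(z, t). f z \<le> ereal t}"

definition convex_fun :: "('a::real_vector \<Rightarrow> ereal) \<Rightarrow> bool" where
  "convex_fun f \<longleftrightarrow> convex (Epi f)"

definition proper_fun :: "('a::real_vector \<Rightarrow> ereal) \<Rightarrow> bool" where
  "proper_fun f \<longleftrightarrow> (\<exists>z. f z \<noteq> \<infinity>) \<and> (\<forall>z. f z \<noteq> -\<infinity>)"

definition conv_fun :: "('a::real_vector \<Rightarrow> ereal) \<Rightarrow> 'a \<Rightarrow> ereal" where
  "conv_fun f z = Inf {ereal t | t. (z, t) \<in> convex hull (Epi f)}"

definition Graph :: "('x \<Rightarrow> 'y set) \<Rightarrow> ('x \<times> 'y) set" where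
  "Graph T = {(x, y). y \<in> T x}"

definition inv_multi :: "('x \<Rightarrow> 'y set) \<Rightarrow> 'y \<Rightarrow> 'x set" where
  "inv_multi T y = {x. y \<in> T x}"

text \<open>
  Finite families \<open>(x\<^sub>1, y\<^sub>1), \<dots>, (x\<^sub>n, y\<^sub>n)\<close> are represented by functions on \<^typ>\<open>nat\<close>;
  only the values at the indices that are constrained matter.
\<close>

definition cyclically_monotone ::
  "('x::real_vector \<Rightarrow> 'y::real_vector \<Rightarrow> real) \<Rightarrow> ('x \<Rightarrow> 'y set) \<Rightarrow> bool" where
  "cyclically_monotone b T \<longleftrightarrow>
     (\<forall>n\<ge>(2::nat). \<forall>x y. (\<forall>i\<in>{1..n}. (x i, y i) \<in> Graph T) \<and> x (n + 1) = x 1 \<longrightarrow>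
        (\<Sum>i=1..n. b (x i - x (i + 1)) (y i)) \<ge> 0)"

text \<open>\<open>phi_fin b T n\<close> is only meant for \<open>n \<ge> 1\<close>, and likewise \<open>P_fin b T n\<close> below.\<close>

definition phi_fin ::
  "('x::real_vector \<Rightarrow> 'y::real_vector \<Rightarrow> real) \<Rightarrow> ('x \<Rightarrow> 'y set) \<Rightarrow> nat \<Rightarrow> 'x \<times> 'y \<Rightarrow> ereal" where
  "phi_fin b T n = (\<lambda>(x, y).
     Sup {ereal (b (x - xs 1) (ys 1) + (\<Sum>i=2..n. b (xs (i - 1) - xs i) (ys i)) + b (xs n) y)
          | xs ys. \<forall>i\<in>{1..n}. (xs i, ys i) \<in> Graph T})"

definition phi_inf ::
  "('x::real_vector \<Rightarrow> 'y::real_vector \<Rightarrow> real) \<Rightarrow> ('x \<Rightarrow> 'y set) \<Rightarrow> 'x \<times> 'y \<Rightarrow> ereal" where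
  "phi_inf b T z = (SUP n\<in>{1..}. phi_fin b T n z)"

definition psi_inf ::
  "('x::real_vector \<Rightarrow> 'y::real_vector \<Rightarrow> real) \<Rightarrow> ('x \<Rightarrow> 'y set) \<Rightarrow> 'x \<times> 'y \<Rightarrow> ereal" where
  "psi_inf b T = square_conj b (phi_inf b T)"

definition P_fin ::
  "('x::real_vector \<Rightarrow> 'y::real_vector \<Rightarrow> real) \<Rightarrow> ('x \<Rightarrow> 'y set) \<Rightarrow> nat \<Rightarrow> 'x \<times> 'y \<Rightarrow> ereal" where
  "P_fin b T n = (\<lambda>(x, y).
     if n = 1 then (if (x, y) \<in> Graph T then coupling b (x, y) else \<infinity>)
     else if n = 2 then
       Inf {ereal (b x1 y + b (x - x1) y2) | x1 y2. x1 \<in> inv_multi T y \<and> y2 \<in> T x}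
     else
       Inf {ereal (b (xs 1) y + (\<Sum>i=2..n-1. b (xs i - xs (i - 1)) (ys i))
              + b (x - xs (n - 1)) (ys n))
            | xs ys. xs 1 \<in> inv_multi T y \<and> ys n \<in> T x
                \<and> (\<forall>i\<in>{2..n-1}. (xs i, ys i) \<in> Graph T)})"

definition P_inf ::
  "('x::real_vector \<Rightarrow> 'y::real_vector \<Rightarrow> real) \<Rightarrow> ('x \<Rightarrow> 'y set) \<Rightarrow> 'x \<times> 'y \<Rightarrow> ereal" where
  "P_inf b T z = (INF n\<in>{1..}. P_fin b T n z)"

end

theory Submission
  imports Defs
begin

text \<open>
  Everything is governed by the costs of chains in \<open>Graph T\<close>. A chain \<open>(x\<^sub>1, y\<^sub>1), \<dots>, (x\<^sub>n, y\<^sub>n)\<close>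
  has the cost
  \<open>\<langle>x\<^sub>1, y\<^sub>1\<rangle> + \<langle>x\<^sub>2 - x\<^sub>1, y\<^sub>2\<rangle> + \<dots> + \<langle>x\<^sub>n - x\<^sub>n\<^sub>-\<^sub>1, y\<^sub>n\<rangle>\<close> and the endpoint \<open>(x\<^sub>n, y\<^sub>1)\<close>. Three
  observations about the set \<open>C\<close> of all pairs (endpoint, cost) carry the proof.

  \<^item> Relabelling the defining families shows that \<open>P\<^sub>T\<^sup>\<infinity>\<close> is the lower envelope of \<open>C\<close>, and that
    \<open>\<phi>\<^sub>T\<^sup>\<infinity>\<close> is the supremum of \<open>z \<cdot> w - t\<close> over \<open>(w, t) \<in> C\<close>. Hence \<open>\<phi>\<^sub>T\<^sup>\<infinity>\<close> is the conjugate of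
    \<open>P\<^sub>T\<^sup>\<infinity>\<close>, and \<open>\<psi>\<^sub>T\<^sup>\<infinity>\<close> its biconjugate, a convex minorant of \<open>P\<^sub>T\<^sup>\<infinity>\<close>.

  \<^item> The cyclic sum of a chain read backwards is its cost minus \<open>c\<close> at its endpoint. Hence \<open>T\<close> is
    cyclically monotone if and only if \<open>c \<le> P\<^sub>T\<^sup>\<infinity>\<close>.

  \<^item> Concatenating chains with endpoints \<open>w = (p, q)\<close> and \<open>w' = (p', q')\<close> and costs \<open>t\<close> and \<open>t'\<close>
    gives a chain with endpoint \<open>(p', q)\<close> and cost \<open>t + t' - \<langle>p, q'\<rangle>\<close>. For cyclically monotone
    \<open>T\<close> this cost is at least \<open>\<langle>p', q\<rangle>\<close>, so that \<open>w \<cdot> w' \<le> t + t'\<close>, which says that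
    \<open>\<phi>\<^sub>T\<^sup>\<infinity> \<le> P\<^sub>T\<^sup>\<infinity>\<close>.

  Conjugating \<open>\<phi>\<^sub>T\<^sup>\<infinity> \<le> P\<^sub>T\<^sup>\<infinity>\<close> yields \<open>\<phi>\<^sub>T\<^sup>\<infinity> \<le> \<psi>\<^sub>T\<^sup>\<infinity>\<close>. Because \<open>z \<cdot> z = 2 c(z)\<close>, the conjugate of a
  function that lies below its conjugate is at least \<open>c\<close>, so \<open>c \<le> \<psi>\<^sub>T\<^sup>\<infinity>\<close>. Always
  \<open>\<psi>\<^sub>T\<^sup>\<infinity> \<le> conv P\<^sub>T\<^sup>\<infinity> \<le> P\<^sub>T\<^sup>\<infinity>\<close>, so that (iv), (v) and (vi) each lead back to \<open>c \<le> P\<^sub>T\<^sup>\<infinity>\<close>; and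
  (i), which follows from (ii) because \<open>P\<^sub>T\<^sup>\<infinity> \<le> c\<close> on \<open>Graph T\<close>, does so when \<open>\<phi>\<^sub>T\<^sup>\<infinity>\<close> is evaluated
  at the last point of a chain.
\<close>

section \<open>Conjugation with respect to the pairing\<close>

text \<open>The basic adjunction: for a real minuend, subtrahend and bound can be exchanged, even when
  they are infinite.\<close>

lemma ereal_diff_le_swap:
  fixes p d :: ereal
  shows "ereal r - p \<le> d \<longleftrightarrow> ereal r - d \<le> p"
  by (cases p; cases d) auto

lemma pairing_commute: "pairing b z w = pairing b w z"
  by (simp add: pairing_def)

lemma square_conj_le_iff: "square_conj b f z \<le> d \<longleftrightarrow> (\<forall>w. ereal (pairing b z w) - f w \<le> d)"
  by (simp add: square_conj_def SUP_le_iff)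

lemma square_conj_ge: "ereal (pairing b z w) - f w \<le> square_conj b f z"
  using square_conj_le_iff by blast

lemma square_biconj_le: "square_conj b (square_conj b f) z \<le> f z"
  unfolding square_conj_le_iff
  by (metis ereal_diff_le_swap pairing_commute square_conj_ge)

lemma square_conj_antimono:
  assumes "\<And>w. f w \<le> g w"
  shows "square_conj b g z \<le> square_conj b f z"
  unfolding square_conj_le_iff
  by (meson assms ereal_minus_mono order_refl order_trans square_conj_ge)

text \<open>On the diagonal \<open>z \<cdot> z = 2 c(z)\<close>, so the Fenchel inequality reads
  \<open>2 c(z) \<le> f(z) + f\<^sup>\<box>(z)\<close>; the larger value, here \<open>f\<^sup>\<box>(z)\<close>, is then at least \<open>c(z)\<close>.\<close>

lemma coupling_le_square_conj:
  assumes "f z \<le> square_conj b f z"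
  shows "coupling b z \<le> square_conj b f z"
proof -
  have "ereal (2 * b (fst z) (snd z)) - f z \<le> square_conj b f z"
    using square_conj_ge[of b z z f] by (simp add: pairing_def)
  with assms show ?thesis
    unfolding coupling_def
    by (cases "f z"; cases "square_conj b f z") auto
qed

text \<open>A conjugate is a supremum of affine functions and of the constants \<open>\<plusminus>\<infinity>\<close>.\<close>

lemma convex_fun_square_conj:
  assumes "bilinear b"
  shows "convex_fun (square_conj b f)"
proof -
  have "convex {(z, t). ereal (pairing b z w) - f w \<le> ereal t}" for w
  proof (cases "f w")
    case (real r)
    have "pairing b (u *\<^sub>R z + v *\<^sub>R z') w = u * pairing b z w + v * pairing b z' w" for u v z z'
      using assms
      by (simp add: pairing_def bilinear_ladd bilinear_radd bilinear_lmul bilinear_rmul algebra_simps)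
    moreover have "u * p + v * p' - r \<le> u * t + v * t'"
      if "p - r \<le> t" "p' - r \<le> t'" "0 \<le> u" "0 \<le> v" "u + v = 1" for u v p p' t t' :: real
    proof -
      have "u * (p - r) + v * (p' - r) \<le> u * t + v * t'"
        using that by (intro add_mono mult_left_mono)
      moreover have "u * (p - r) + v * (p' - r) = u * p + v * p' - (u + v) * r"
        by (simp add: algebra_simps)
      ultimately show ?thesis using that by simp
    qed
    ultimately show ?thesis
      by (auto simp: convex_def real)
  qed (simp_all add: case_prod_unfold)
  moreover have "Epi (square_conj b f) = (\<Inter>w. {(z, t). ereal (pairing b z w) - f w \<le> ereal t})"
    by (auto simp: Epi_def square_conj_le_iff)
  ultimately show ?thesis
    by (simp add: convex_fun_def convex_INT)
qed

section \<open>The convex hull of a function\<close>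

lemma le_conv_fun:
  assumes "convex_fun h" "\<And>z. h z \<le> f z"
  shows "h z \<le> conv_fun f z"
proof -
  have "Epi f \<subseteq> Epi h"
    using assms(2) by (auto simp: Epi_def intro: order_trans)
  then have "convex hull (Epi f) \<subseteq> Epi h"
    using assms(1) by (simp add: convex_fun_def hull_minimal)
  then show ?thesis
    by (auto simp: conv_fun_def Epi_def intro!: Inf_greatest)
qed

lemma conv_fun_le: "conv_fun f z \<le> f z"
proof (rule ereal_le_real)
  fix t assume "f z \<le> ereal t"
  then have "(z, t) \<in> convex hull (Epi f)"
    by (auto simp: Epi_def intro: hull_inc)
  then show "conv_fun f z \<le> ereal t"
    by (auto simp: conv_fun_def intro!: Inf_lower)
qed

section \<open>Chains and their costs\<close>

definition chain :: "('x \<Rightarrow> 'y set) \<Rightarrow> nat \<Rightarrow> (nat \<Rightarrow> 'x) \<Rightarrow> (nat \<Rightarrow> 'y) \<Rightarrow> bool" where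
  "chain T n xs ys \<longleftrightarrow> (\<forall>i\<in>{1..n}. (xs i, ys i) \<in> Graph T)"

definition chain_cost ::
  "('x::real_vector \<Rightarrow> 'y::real_vector \<Rightarrow> real) \<Rightarrow> nat \<Rightarrow> (nat \<Rightarrow> 'x) \<Rightarrow> (nat \<Rightarrow> 'y) \<Rightarrow> real" where
  "chain_cost b n xs ys = b (xs 1) (ys 1) + (\<Sum>i=2..n. b (xs i - xs (i - 1)) (ys i))"

definition endpoint_costs ::
  "('x::real_vector \<Rightarrow> 'y::real_vector \<Rightarrow> real) \<Rightarrow> ('x \<Rightarrow> 'y set) \<Rightarrow> (('x \<times> 'y) \<times> real) set" where
  "endpoint_costs b T =
     {((xs n, ys 1), chain_cost b n xs ys) | n xs ys. 1 \<le> n \<and> chain T n xs ys}"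

lemma endpoint_costsI:
  "1 \<le> n \<Longrightarrow> chain T n xs ys \<Longrightarrow> ((xs n, ys 1), chain_cost b n xs ys) \<in> endpoint_costs b T"
  unfolding endpoint_costs_def by blast

lemma Ball_endpoint_costs_iff:
  "(\<forall>(w, t)\<in>endpoint_costs b T. Q w t) \<longleftrightarrow>
   (\<forall>n\<ge>1. \<forall>xs ys. chain T n xs ys \<longrightarrow> Q (xs n, ys 1) (chain_cost b n xs ys))"
  unfolding endpoint_costs_def by blast

lemma Graph_imp_endpoint_costs:
  assumes "z \<in> Graph T"
  shows "(z, b (fst z) (snd z)) \<in> endpoint_costs b T"
  using endpoint_costsI[of 1 T "\<lambda>_. fst z" "\<lambda>_. snd z" b] assms
  by (simp add: chain_def chain_cost_def)

lemma chain_cost_cong: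
  assumes "1 \<le> n" "\<And>i. i \<in> {1..n} \<Longrightarrow> xs i = xs' i" "\<And>i. i \<in> {1..n} \<Longrightarrow> ys i = ys' i"
  shows "chain_cost b n xs ys = chain_cost b n xs' ys'"
proof -
  have "b (xs i - xs (i - 1)) (ys i) = b (xs' i - xs' (i - 1)) (ys' i)" if "i \<in> {2..n}" for i
  proof -
    have "i \<in> {1..n}" "i - 1 \<in> {1..n}" using that by auto
    then show ?thesis using assms(2,3) by metis
  qed
  then show ?thesis
    using assms by (simp add: chain_cost_def)
qed

text \<open>If \<open>(a, q')\<close> is the first point of the second chain, writing its first cost term \<open>\<langle>a, q'\<rangle>\<close>
  as \<open>\<langle>p, q'\<rangle> + \<langle>a - p, q'\<rangle>\<close> produces the link from the last point of the first chain; only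
  \<open>\<langle>p, q'\<rangle>\<close> is lost.\<close>

lemma endpoint_costs_concat:
  assumes b: "bilinear b"
    and w: "((p, q), t) \<in> endpoint_costs b T" and w': "((p', q'), t') \<in> endpoint_costs b T"
  shows "((p', q), t + t' - b p q') \<in> endpoint_costs b T"
proof -
  obtain n xs ys where 1: "1 \<le> n" "chain T n xs ys" "p = xs n" "q = ys 1" "t = chain_cost b n xs ys"
    using w unfolding endpoint_costs_def by auto
  obtain m us vs where 2: "1 \<le> m" "chain T m us vs" "p' = us m" "q' = vs 1" "t' = chain_cost b m us vs"
    using w' unfolding endpoint_costs_def by auto
  define X where "X i = (if i \<le> n then xs i else us (i - n))" for i
  define Y where "Y i = (if i \<le> n then ys i else vs (i - n))" for i
  have "chain T (n + m) X Y"
    unfolding chain_def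
  proof
    fix i assume "i \<in> {1..n + m}"
    then have "i \<in> {1..n} \<or> \<not> i \<le> n \<and> i - n \<in> {1..m}" by auto
    then show "(X i, Y i) \<in> Graph T"
      using 1(2) 2(2) by (auto simp: chain_def X_def Y_def)
  qed
  moreover have "X (n + m) = p'" "Y 1 = q"
    using 1 2 by (auto simp: X_def Y_def)
  moreover have "chain_cost b (n + m) X Y = t + t' - b p q'"
  proof -
    let ?g = "\<lambda>i. b (X i - X (i - 1)) (Y i)"
    have "sum ?g {2..n + m} = sum ?g {2..n} + sum ?g {n + 1..n + m}"
      using 1(1) sum.ub_add_nat[of 2 n ?g m] by simp
    moreover have "sum ?g {n + 1..n + m} = (\<Sum>i=1..m. ?g (i + n))"
      using sum.shift_bounds_cl_nat_ivl[of ?g 1 n m] by (simp add: add.commute)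
    moreover have "\<dots> = ?g (1 + n) + (\<Sum>i=2..m. ?g (i + n))"
      using 2(1) by (simp add: sum.atLeast_Suc_atMost numeral_2_eq_2)
    moreover have "?g (1 + n) = b (us 1) (vs 1) - b p q'"
      using 1 2 by (simp add: X_def Y_def bilinear_lsub[OF b])
    moreover have "(\<Sum>i=2..m. ?g (i + n)) = (\<Sum>i=2..m. b (us i - us (i - 1)) (vs i))"
      by (rule sum.cong) (auto simp: X_def Y_def)
    moreover have "b (X 1) (Y 1) + sum ?g {2..n} = t"
      using chain_cost_cong[of n X xs Y ys b] 1 by (simp add: chain_cost_def X_def Y_def)
    ultimately show ?thesis
      using 2(5) by (simp add: chain_cost_def)
  qed
  ultimately show ?thesis
    using endpoint_costsI[of "n + m" T X Y b] 1(1) by simp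
qed

section \<open>The functions of the theorem in terms of chain costs\<close>

lemma P_fin_eq:
  assumes "1 \<le> n"
  shows "P_fin b T n z =
    Inf {ereal (chain_cost b n xs ys) | xs ys. chain T n xs ys \<and> (xs n, ys 1) = z}"
proof -
  obtain x y where z: "z = (x, y)" by fastforce
  consider "n = 1" | "n = 2" | "3 \<le> n" using assms by linarith
  then show ?thesis
  proof cases
    case 1
    have "{ereal (chain_cost b 1 xs ys) | xs ys. chain T 1 xs ys \<and> (xs 1, ys 1) = z}
      = (if z \<in> Graph T then {coupling b z} else {})"
      by (auto simp: chain_def chain_cost_def coupling_def z
          intro: exI[of _ "\<lambda>_. x"] exI[of _ "\<lambda>_. y"])
    then show ?thesis
      using 1 by (simp add: P_fin_def z top_ereal_def)
  next
    case 2
    have iv: "{1..2::nat} = {1, 2}" by auto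
    have "{ereal (b x1 y + b (x - x1) y2) | x1 y2. x1 \<in> inv_multi T y \<and> y2 \<in> T x}
      = {ereal (chain_cost b 2 xs ys) | xs ys. chain T 2 xs ys \<and> (xs 2, ys 1) = z}"
      (is "?A = ?B")
    proof (intro equalityI subsetI)
      fix a assume "a \<in> ?A"
      then obtain x1 y2 where "a = ereal (b x1 y + b (x - x1) y2)" "x1 \<in> inv_multi T y" "y2 \<in> T x"
        by blast
      then show "a \<in> ?B"
        by (intro CollectI exI[of _ "\<lambda>i. if i = 1 then x1 else x"]
            exI[of _ "\<lambda>i. if i = 1 then y else y2"])
          (simp add: chain_def chain_cost_def iv z inv_multi_def Graph_def)
    next
      fix a assume "a \<in> ?B"
      then obtain xs ys where "a = ereal (chain_cost b 2 xs ys)" "chain T 2 xs ys"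
        "xs 2 = x" "ys 1 = y"
        by (auto simp: z)
      then show "a \<in> ?A"
        by (intro CollectI exI[of _ "xs 1"] exI[of _ "ys 2"])
          (auto simp: chain_def chain_cost_def iv inv_multi_def Graph_def)
    qed
    then show ?thesis
      using 2 by (simp add: P_fin_def z)
  next
    case 3
    let ?cost = "\<lambda>xs ys. b (xs 1) y + (\<Sum>i=2..n-1. b (xs i - xs (i - 1)) (ys i))
      + b (x - xs (n - 1)) (ys n)"
    let ?adm = "\<lambda>xs ys. xs 1 \<in> inv_multi T y \<and> ys n \<in> T x \<and> (\<forall>i\<in>{2..n-1}. (xs i, ys i) \<in> Graph T)"
    have cost: "chain_cost b n xs ys = ?cost xs ys" if "xs n = x" "ys 1 = y" for xs ys
    proof -
      obtain k where "n = Suc k" "2 \<le> k" using 3 by (cases n) auto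
      then show ?thesis using that by (simp add: chain_cost_def)
    qed
    have adm: "chain T n xs ys \<longleftrightarrow> ?adm xs ys" if "xs n = x" "ys 1 = y" for xs ys
    proof -
      have "{1..n} = insert 1 (insert n {2..n-1})" using 3 by auto
      then show ?thesis using that by (auto simp: chain_def inv_multi_def Graph_def)
    qed
    have "{ereal (?cost xs ys) | xs ys. ?adm xs ys}
      = {ereal (chain_cost b n xs ys) | xs ys. chain T n xs ys \<and> (xs n, ys 1) = z}"
      (is "?A = ?B")
    proof (intro equalityI subsetI)
      fix a assume "a \<in> ?A"
      then obtain xs ys where a: "a = ereal (?cost xs ys)" "?adm xs ys" by blast
      \<comment> \<open>The families for \<open>P_fin\<close> leave \<open>xs n\<close> and \<open>ys 1\<close> unconstrained; the endpoint fills them in.\<close>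
      let ?X = "xs(n := x)" and ?Y = "ys(1 := y)"
      have "?cost ?X ?Y = ?cost xs ys"
        using 3 by (auto intro!: sum.cong)
      moreover have "?adm ?X ?Y" using a(2) 3 by auto
      ultimately show "a \<in> ?B"
        using cost[of ?X ?Y] adm[of ?X ?Y] a(1)
        by (intro CollectI exI[of _ ?X] exI[of _ ?Y]) (simp add: z)
    next
      fix a assume "a \<in> ?B"
      then obtain xs ys where "a = ereal (chain_cost b n xs ys)" "chain T n xs ys" "xs n = x" "ys 1 = y"
        by (auto simp: z)
      then show "a \<in> ?A"
        using cost adm by blast
    qed
    then show ?thesis
      using 3 by (simp add: P_fin_def z)
  qed
qed

lemma le_P_inf_iff: "d \<le> P_inf b T z \<longleftrightarrow> (\<forall>t. (z, t) \<in> endpoint_costs b T \<longrightarrow> d \<le> ereal t)"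
proof -
  have "d \<le> P_inf b T z \<longleftrightarrow> (\<forall>n\<ge>1. d \<le> P_fin b T n z)"
    by (auto simp: P_inf_def le_INF_iff)
  also have "\<dots> \<longleftrightarrow> (\<forall>n\<ge>1. \<forall>xs ys. chain T n xs ys \<and> (xs n, ys 1) = z \<longrightarrow>
      d \<le> ereal (chain_cost b n xs ys))"
    by (simp only: P_fin_eq le_Inf_iff cong: imp_cong) blast
  also have "\<dots> \<longleftrightarrow> (\<forall>t. (z, t) \<in> endpoint_costs b T \<longrightarrow> d \<le> ereal t)"
    unfolding endpoint_costs_def by blast
  finally show ?thesis .
qed

lemma P_inf_le:
  assumes "(z, t) \<in> endpoint_costs b T"
  shows "P_inf b T z \<le> ereal t"
  using le_P_inf_iff[of "P_inf b T z" b T z] assms by blast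

lemma le_P_inf_all_iff:
  "(\<forall>z. g z \<le> P_inf b T z) \<longleftrightarrow> (\<forall>(w, t)\<in>endpoint_costs b T. g w \<le> ereal t)"
  by (auto simp: le_P_inf_iff)

text \<open>The quantity maximised in \<open>\<phi>\<^sub>T\<close> is the pairing of the argument with the endpoint of the
  family, minus the cost of the family.\<close>

lemma phi_inf_le_iff:
  assumes "bilinear b"
  shows "phi_inf b T z \<le> d \<longleftrightarrow>
    (\<forall>(w, t)\<in>endpoint_costs b T. ereal (pairing b z w) - ereal t \<le> d)"
proof -
  have eq: "b (fst z - xs 1) (ys 1) + (\<Sum>i=2..n. b (xs (i - 1) - xs i) (ys i)) + b (xs n) (snd z)
    = pairing b z (xs n, ys 1) - chain_cost b n xs ys" for n xs ys
  proof -
    have "(\<Sum>i=2..n. b (xs (i - 1) - xs i) (ys i)) = - (\<Sum>i=2..n. b (xs i - xs (i - 1)) (ys i))"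
      by (simp add: bilinear_lsub[OF assms] sum_negf[symmetric])
    then show ?thesis
      by (simp add: pairing_def chain_cost_def bilinear_lsub[OF assms])
  qed
  have "phi_inf b T z \<le> d \<longleftrightarrow> (\<forall>n\<ge>1. phi_fin b T n z \<le> d)"
    by (auto simp: phi_inf_def SUP_le_iff)
  also have "\<dots> \<longleftrightarrow> (\<forall>n\<ge>1. \<forall>xs ys. chain T n xs ys \<longrightarrow>
      ereal (pairing b z (xs n, ys 1) - chain_cost b n xs ys) \<le> d)"
    unfolding phi_fin_def case_prod_unfold eq chain_def[symmetric] Sup_le_iff by blast
  finally show ?thesis
    unfolding Ball_endpoint_costs_iff by simp
qed

lemma phi_inf_eq_square_conj:
  assumes "bilinear b"
  shows "phi_inf b T = square_conj b (P_inf b T)"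
proof
  fix z
  have "phi_inf b T z \<le> d \<longleftrightarrow> square_conj b (P_inf b T) z \<le> d" for d
    unfolding phi_inf_le_iff[OF assms] square_conj_le_iff
    unfolding ereal_diff_le_swap[of _ _ d] le_P_inf_all_iff ..
  then show "phi_inf b T z = square_conj b (P_inf b T) z"
    by (meson order_antisym order_refl)
qed

lemma psi_inf_le_P_inf:
  assumes "bilinear b"
  shows "psi_inf b T z \<le> P_inf b T z"
  unfolding psi_inf_def phi_inf_eq_square_conj[OF assms] by (rule square_biconj_le)

lemma coupling_le_phi_inf:
  assumes "bilinear b" "z \<in> Graph T"
  shows "coupling b z \<le> phi_inf b T z"
proof -
  have "ereal (pairing b z z) - ereal (b (fst z) (snd z)) \<le> phi_inf b T z"
    using phi_inf_le_iff[OF assms(1), of T z "phi_inf b T z"] Graph_imp_endpoint_costs[OF assms(2)]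
    by blast
  then show ?thesis
    by (simp add: pairing_def coupling_def)
qed

section \<open>Cyclic monotonicity as a bound on chain costs\<close>

text \<open>The index \<open>0\<close> lies outside the chain and serves to close it into a cycle. The reversal of
  indices is needed since cyclic monotonicity takes differences with the successor and chain costs
  with the predecessor.\<close>

lemma cyclic_sum_eq:
  assumes "bilinear b" "1 \<le> n" "xs 0 = xs n"
  shows "(\<Sum>i=1..n. b (xs (n + 1 - i) - xs (n + 1 - (i + 1))) (ys (n + 1 - i)))
    = chain_cost b n xs ys - b (xs n) (ys 1)"
proof -
  have "(\<Sum>i=1..n. b (xs (n + 1 - i) - xs (n + 1 - (i + 1))) (ys (n + 1 - i)))
      = (\<Sum>j=1..n. b (xs j - xs (j - 1)) (ys j))"
    using sum.atLeastAtMost_rev[of "\<lambda>j. b (xs j - xs (j - 1)) (ys j)" 1 n] by simp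
  also have "\<dots> = b (xs 1 - xs n) (ys 1) + (\<Sum>j=2..n. b (xs j - xs (j - 1)) (ys j))"
    using assms(2,3) by (simp add: sum.atLeast_Suc_atMost numeral_2_eq_2)
  finally show ?thesis
    by (simp add: chain_cost_def bilinear_lsub[OF assms(1)])
qed

lemma cyclically_monotone_iff_endpoint_costs:
  assumes "bilinear b"
  shows "cyclically_monotone b T \<longleftrightarrow> (\<forall>(w, t)\<in>endpoint_costs b T. coupling b w \<le> ereal t)"
proof -
  have "cyclically_monotone b T \<longleftrightarrow>
    (\<forall>n\<ge>1. \<forall>xs ys. chain T n xs ys \<longrightarrow> b (xs n) (ys 1) \<le> chain_cost b n xs ys)"
  proof (intro iffI allI impI)
    fix n xs ys
    assume cm: "cyclically_monotone b T" and n: "1 \<le> n" and ch: "chain T n xs ys"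
    show "b (xs n) (ys 1) \<le> chain_cost b n xs ys"
    proof (cases "n = 1")
      case True
      then show ?thesis by (simp add: chain_cost_def)
    next
      case False
      let ?xs = "xs(0 := xs n)"
      have "\<forall>i\<in>{1..n}. (?xs (n + 1 - i), ys (n + 1 - i)) \<in> Graph T"
      proof
        fix i assume "i \<in> {1..n}"
        then have "n + 1 - i \<in> {1..n}" by auto
        with ch show "(?xs (n + 1 - i), ys (n + 1 - i)) \<in> Graph T"
          unfolding chain_def by auto
      qed
      moreover have "?xs (n + 1 - (n + 1)) = ?xs (n + 1 - 1)"
        by simp
      moreover have "2 \<le> n" using n False by simp
      ultimately have "0 \<le> (\<Sum>i=1..n. b (?xs (n + 1 - i) - ?xs (n + 1 - (i + 1))) (ys (n + 1 - i)))"
        using cm[unfolded cyclically_monotone_def, rule_format,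
            of n "\<lambda>i. ?xs (n + 1 - i)" "\<lambda>i. ys (n + 1 - i)"] by blast
      also have "\<dots> = chain_cost b n ?xs ys - b (?xs n) (ys 1)"
        using n by (intro cyclic_sum_eq[OF assms]) auto
      also have "chain_cost b n ?xs ys = chain_cost b n xs ys"
        using n by (intro chain_cost_cong) auto
      finally show ?thesis using n by simp
    qed
  next
    assume *: "\<forall>n\<ge>1. \<forall>xs ys. chain T n xs ys \<longrightarrow> b (xs n) (ys 1) \<le> chain_cost b n xs ys"
    show "cyclically_monotone b T"
      unfolding cyclically_monotone_def
    proof (intro allI impI)
      fix n :: nat and x y
      assume n: "2 \<le> n" and xy: "(\<forall>i\<in>{1..n}. (x i, y i) \<in> Graph T) \<and> x (n + 1) = x 1"
      let ?xs = "\<lambda>j. x (n + 1 - j)" and ?ys = "\<lambda>j. y (n + 1 - j)"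
      have "chain T n ?xs ?ys"
        unfolding chain_def
      proof
        fix j assume "j \<in> {1..n}"
        then have "n + 1 - j \<in> {1..n}" by auto
        with xy show "(?xs j, ?ys j) \<in> Graph T" by blast
      qed
      then have "0 \<le> chain_cost b n ?xs ?ys - b (?xs n) (?ys 1)"
        using *[rule_format, of n ?xs ?ys] n by linarith
      also have "\<dots> = (\<Sum>i=1..n. b (?xs (n + 1 - i) - ?xs (n + 1 - (i + 1))) (?ys (n + 1 - i)))"
        using n xy by (intro cyclic_sum_eq[OF assms, symmetric]) auto
      also have "\<dots> = (\<Sum>i=1..n. b (x i - x (i + 1)) (y i))"
        by (rule sum.cong) auto
      finally show "0 \<le> (\<Sum>i=1..n. b (x i - x (i + 1)) (y i))" .
    qed
  qed
  then show ?thesis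
    unfolding Ball_endpoint_costs_iff by (simp add: coupling_def)
qed

lemma cyclically_monotone_iff_P_inf:
  assumes "bilinear b"
  shows "cyclically_monotone b T \<longleftrightarrow> (\<forall>z. coupling b z \<le> P_inf b T z)"
  unfolding cyclically_monotone_iff_endpoint_costs[OF assms] le_P_inf_all_iff ..

text \<open>Both functions are envelopes over chains; the inequality compares two chains, and it is the
  bound on the cost of their concatenation.\<close>

lemma cyclically_monotone_imp_phi_inf_le_P_inf:
  assumes b: "bilinear b" and cm: "cyclically_monotone b T"
  shows "phi_inf b T z \<le> P_inf b T z"
proof -
  have "ereal (pairing b z w) - ereal t \<le> ereal s"
    if "(z, s) \<in> endpoint_costs b T" "(w, t) \<in> endpoint_costs b T" for s w t
  proof -
    have "((fst w, snd z), s + t - b (fst z) (snd w)) \<in> endpoint_costs b T"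
      using that by (intro endpoint_costs_concat[OF b]) auto
    then have "coupling b (fst w, snd z) \<le> ereal (s + t - b (fst z) (snd w))"
      using cm unfolding cyclically_monotone_iff_endpoint_costs[OF b] by blast
    then show ?thesis
      by (simp add: coupling_def pairing_def)
  qed
  then show ?thesis
    unfolding le_P_inf_iff phi_inf_le_iff[OF b] by blast
qed

text \<open>For a chain \<open>(x\<^sub>1, y\<^sub>1), \<dots>, (x\<^sub>n, y\<^sub>n)\<close>, the bound \<open>\<phi> \<le> c\<close> is used at its last point: since
  \<open>(x\<^sub>n, y\<^sub>n) \<cdot> (x\<^sub>n, y\<^sub>1) = \<langle>x\<^sub>n, y\<^sub>1\<rangle> + c(x\<^sub>n, y\<^sub>n)\<close>, the term \<open>c(x\<^sub>n, y\<^sub>n)\<close> cancels.\<close>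

lemma phi_inf_le_coupling_imp_cyclically_monotone:
  assumes b: "bilinear b" and le: "\<And>z. z \<in> Graph T \<Longrightarrow> phi_inf b T z \<le> coupling b z"
  shows "cyclically_monotone b T"
  unfolding cyclically_monotone_iff_endpoint_costs[OF b] Ball_endpoint_costs_iff
proof (intro allI impI)
  fix n :: nat and xs ys
  assume n: "1 \<le> n" and ch: "chain T n xs ys"
  have "(xs n, ys n) \<in> Graph T"
    using n ch by (simp add: chain_def)
  then have "phi_inf b T (xs n, ys n) \<le> coupling b (xs n, ys n)"
    by (rule le)
  then have "ereal (pairing b (xs n, ys n) (xs n, ys 1)) - ereal (chain_cost b n xs ys)
      \<le> coupling b (xs n, ys n)"
    using endpoint_costsI[OF n ch, of b] unfolding phi_inf_le_iff[OF b] by blast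
  then show "coupling b (xs n, ys 1) \<le> ereal (chain_cost b n xs ys)"
    by (simp add: pairing_def coupling_def)
qed

section \<open>The characterisations\<close>

text \<open>The natural candidate is \<open>\<psi>\<^sub>T\<^sup>\<infinity>\<close>, which is finite on \<open>Graph T\<close>. If the graph is empty, then
  \<open>\<psi>\<^sub>T\<^sup>\<infinity>\<close> is identically \<open>\<infinity>\<close> and hence not proper, and the indicator function of the origin
  takes its place.\<close>

lemma proper_convex_between:
  assumes b: "bilinear b" and psi: "\<And>z. coupling b z \<le> psi_inf b T z"
  obtains h where "proper_fun h" "convex_fun h" "\<And>z. coupling b z \<le> h z" "\<And>z. h z \<le> P_inf b T z"
proof (cases "Graph T = {}")
  case True
  let ?h = "\<lambda>z :: 'a \<times> 'b. if z = 0 then 0 else \<infinity> :: ereal"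
  have "Epi ?h = {0} \<times> {0..}"
    by (simp add: Epi_def set_eq_iff mem_Times_iff case_prod_unfold)
  then have "convex_fun ?h"
    by (simp add: convex_fun_def convex_Times)
  moreover have "coupling b z \<le> ?h z" for z
    by (simp add: coupling_def bilinear_lzero[OF b])
  moreover have "endpoint_costs b T = {}"
    using True by (force simp: endpoint_costs_def chain_def)
  then have "?h z \<le> P_inf b T z" for z
    unfolding le_P_inf_iff by simp
  moreover have "proper_fun ?h"
    by (simp add: proper_fun_def del: split_paired_Ex)
  ultimately show thesis by (intro that[of ?h])
next
  case False
  then obtain z where z: "z \<in> Graph T" by blast
  have "psi_inf b T z \<le> ereal (b (fst z) (snd z))"
    using psi_inf_le_P_inf[OF b] P_inf_le[OF Graph_imp_endpoint_costs[OF z]] by (rule order_trans)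
  then have "psi_inf b T z \<noteq> \<infinity>" by auto
  moreover have "psi_inf b T w \<noteq> -\<infinity>" for w
    using psi[of w] by (auto simp: coupling_def)
  ultimately have "proper_fun (psi_inf b T)"
    unfolding proper_fun_def by blast
  moreover have "convex_fun (psi_inf b T)"
    unfolding psi_inf_def by (rule convex_fun_square_conj[OF b])
  ultimately show thesis
    using psi psi_inf_le_P_inf[OF b] by (rule that)
qed

theorem theorem12:
  fixes b :: "'x::real_vector \<Rightarrow> 'y::real_vector \<Rightarrow> real"
    and T :: "'x \<Rightarrow> 'y set"
  assumes "bilinear b"
  shows "(cyclically_monotone b T \<longleftrightarrow> Graph T \<subseteq> {z. phi_inf b T z \<le> coupling b z})
    \<and> (cyclically_monotone b T \<longleftrightarrow> Graph T \<subseteq> {z. phi_inf b T z = coupling b z})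
    \<and> (cyclically_monotone b T \<longleftrightarrow> (\<forall>z. phi_inf b T z \<le> P_inf b T z))
    \<and> (cyclically_monotone b T \<longleftrightarrow> (\<forall>z. phi_inf b T z \<le> psi_inf b T z))
    \<and> (cyclically_monotone b T \<longleftrightarrow> (\<forall>z. psi_inf b T z \<ge> coupling b z))
    \<and> (cyclically_monotone b T \<longleftrightarrow> (\<forall>z. conv_fun (P_inf b T) z \<ge> coupling b z))
    \<and> (cyclically_monotone b T \<longleftrightarrow>
         (\<exists>h :: 'x \<times> 'y \<Rightarrow> ereal. proper_fun h \<and> convex_fun h
            \<and> (\<forall>z. coupling b z \<le> h z \<and> h z \<le> P_inf b T z)))"
proof -
  let ?CM = "cyclically_monotone b T"
  let ?i = "Graph T \<subseteq> {z. phi_inf b T z \<le> coupling b z}"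
  let ?i' = "Graph T \<subseteq> {z. phi_inf b T z = coupling b z}"
  let ?ii = "\<forall>z. phi_inf b T z \<le> P_inf b T z"
  let ?iii = "\<forall>z. phi_inf b T z \<le> psi_inf b T z"
  let ?iv = "\<forall>z. psi_inf b T z \<ge> coupling b z"
  let ?v = "\<forall>z. conv_fun (P_inf b T) z \<ge> coupling b z"
  let ?vi = "\<exists>h :: 'x \<times> 'y \<Rightarrow> ereal. proper_fun h \<and> convex_fun h
    \<and> (\<forall>z. coupling b z \<le> h z \<and> h z \<le> P_inf b T z)"
  have CM_ii: ?ii if ?CM
    using cyclically_monotone_imp_phi_inf_le_P_inf[OF assms that] by blast
  have ii_i: ?i if ?ii
  proof
    fix z assume "z \<in> Graph T"
    then have "P_inf b T z \<le> coupling b z"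
      unfolding coupling_def by (intro P_inf_le Graph_imp_endpoint_costs)
    with that show "z \<in> {z. phi_inf b T z \<le> coupling b z}"
      using order_trans by blast
  qed
  have i_iff_i': "?i \<longleftrightarrow> ?i'"
    using coupling_le_phi_inf[OF assms, of _ T] by (auto intro: order_antisym)
  have i_CM: ?CM if ?i
    using phi_inf_le_coupling_imp_cyclically_monotone[OF assms] that by blast
  have ii_iii: ?iii if ?ii
  proof
    fix z
    have "phi_inf b T z = square_conj b (P_inf b T) z"
      by (simp add: phi_inf_eq_square_conj[OF assms])
    also have "\<dots> \<le> square_conj b (phi_inf b T) z"
      using that by (intro square_conj_antimono) blast
    finally show "phi_inf b T z \<le> psi_inf b T z"
      by (simp add: psi_inf_def)
  qed
  have iii_iv: ?iv if ?iii
    using that coupling_le_square_conj[of "phi_inf b T" _ b] by (auto simp: psi_inf_def)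
  have iv_v: ?v if ?iv
  proof
    fix z
    have "coupling b z \<le> psi_inf b T z" using that by blast
    also have "\<dots> \<le> conv_fun (P_inf b T) z"
      using psi_inf_le_P_inf[OF assms] convex_fun_square_conj[OF assms]
      by (intro le_conv_fun) (simp_all add: psi_inf_def)
    finally show "coupling b z \<le> conv_fun (P_inf b T) z" .
  qed
  have iv_vi: ?vi if ?iv
    using proper_convex_between[OF assms, of T] that by metis
  have v_CM: ?CM if ?v
    unfolding cyclically_monotone_iff_P_inf[OF assms]
    using that conv_fun_le order_trans by blast
  have vi_CM: ?CM if ?vi
    unfolding cyclically_monotone_iff_P_inf[OF assms]
    using that order_trans by blast
  from CM_ii ii_i i_iff_i' i_CM ii_iii iii_iv iv_v iv_vi v_CM vi_CM show ?thesis
    by argo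
qed

end
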